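(* Let $G$ be a finite simple graph with vertex set $\{x_1,\ldots,x_n\}$ and at least one edge, let $K$ be a field and $S=K[x_1,\ldots,x_n]$. If the cover ideal $J(G)\subset S$ has a linear resolution (equivalently, $S/I(G)$ is Cohen–Macaulay), then $\mathrm v(J(G)^k)=\alpha(J(G))k-1$ for all $k\ge 1$.
   Context: $S=\bigoplus_{d\ge 0}S_d$ is graded with $\deg x_i=1$; vertices of $G$ are identified with variables. The edge ideal is $I(G)=\langle x_ix_j\mid \{x_i,x_j\}\in E(G)\rangle$. A vertex cover of $G$ is a set $C\subset V(G)$ meeting every edge; it is minimal if it is minimal under inclusion. The cover ideal is $J(G)=\langle \prod_{x_i\in C}x_i\mid C \text{ a minimal vertex cover of } G\rangle$. For a nonzero graded ideal $I$, $\alpha(I):=\min\{\deg(f)\mid f\in I\setminus\{0\}\}$ (over homogeneous $f$). An equigenerated graded ideal $I$ (generated by homogeneous elements of a single degree) has a linear resolution if its Castelnuovo–Mumford regularity satisfies $\operatorname{reg}(I)=\alpha(I)$. For a proper graded ideal $I$, $\mathrm{v}(I):=\min\{d\geq 0\mid \exists f\in S_d,\ \mathfrak{p}\in\operatorname{Ass}(I)\text{ with }(I:f)=\mathfrak{p}\}$, where $\operatorname{Ass}(I)$ is the set of associated primes of $S/I$ and $(I:f)=\{g\in S\mid gf\in I\}$. *)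

theory Defs
  imports "HOL-Library.Poly_Mapping" "Jordan_Normal_Form.Matrix_Kernel"
begin

section \<open>The polynomial ring\<close>

text \<open>The finite type \<open>'n\<close> indexes the variables: for a field \<open>'k\<close>, the type \<open>('n, 'k) mpoly\<close> is
  \<open>K[x\<^sub>1, \<dots>, x\<^sub>n]\<close> with \<open>n = CARD('n)\<close>. Monomials are exponent functions \<open>'n \<Rightarrow>\<^sub>0 nat\<close>.\<close>

type_synonym ('n, 'k) mpoly = "('n \<Rightarrow>\<^sub>0 nat) \<Rightarrow>\<^sub>0 'k"

definition var :: "'n \<Rightarrow> ('n, 'k::field) mpoly" where
  "var v = Poly_Mapping.single (Poly_Mapping.single v 1) 1"

definition mon_deg :: "('n::finite \<Rightarrow>\<^sub>0 nat) \<Rightarrow> nat" where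
  "mon_deg m = (\<Sum>v\<in>UNIV. Poly_Mapping.lookup m v)"

text \<open>The graded piece \<open>S\<^sub>d\<close>; it contains \<open>0\<close>.\<close>

definition homog :: "nat \<Rightarrow> ('n::finite, 'k::field) mpoly set" where
  "homog d = {f. \<forall>m\<in>Poly_Mapping.keys f. mon_deg m = d}"


section \<open>Ideals\<close>

text \<open>Ideals are the submodules of a commutative ring, viewed as a module over itself:
  \<open>self_module.subspace I\<close> says that \<open>I\<close> is an ideal, and \<open>self_module.span B\<close> is the ideal
  generated by \<open>B\<close>.\<close>

global_interpretation self_module: module "(*) :: 'a::comm_ring_1 \<Rightarrow> 'a \<Rightarrow> 'a"
  by unfold_locales (simp_all add: algebra_simps)

primrec ideal_power :: "'a::comm_ring_1 set \<Rightarrow> nat \<Rightarrow> 'a set" where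
  "ideal_power I 0 = UNIV"
| "ideal_power I (Suc k) = self_module.span {a * b | a b. a \<in> I \<and> b \<in> ideal_power I k}"

definition prime_ideal :: "'a::comm_ring_1 set \<Rightarrow> bool" where
  "prime_ideal P \<longleftrightarrow> self_module.subspace P \<and> P \<noteq> UNIV \<and>
     (\<forall>a b. a * b \<in> P \<longrightarrow> a \<in> P \<or> b \<in> P)"

definition colon :: "'a::comm_ring_1 set \<Rightarrow> 'a \<Rightarrow> 'a set" where
  "colon I f = {g. g * f \<in> I}"

text \<open>\<open>Ass I\<close> is the set of associated primes of \<open>S/I\<close>, that is, the primes which are the
  annihilator of some element of \<open>S/I\<close>; the annihilator of the class of \<open>f\<close> is \<open>(I : f)\<close>.\<close>

definition Ass :: "'a::comm_ring_1 set \<Rightarrow> 'a set set" where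
  "Ass I = {P. prime_ideal P \<and> (\<exists>f. P = colon I f)}"

definition alpha :: "('n::finite, 'k::field) mpoly set \<Rightarrow> nat" where
  "alpha I = (LEAST d. \<exists>f\<in>I. f \<noteq> 0 \<and> f \<in> homog d)"

definition v_number :: "('n::finite, 'k::field) mpoly set \<Rightarrow> nat" where
  "v_number I = (LEAST d. \<exists>f\<in>homog d. \<exists>P\<in>Ass I. colon I f = P)"


section \<open>Regularity and linear resolutions\<close>

text \<open>A minimal graded free resolution
  \<open>\<cdots> \<rightarrow> F\<^sub>2 \<rightarrow> F\<^sub>1 \<rightarrow> F\<^sub>0 \<rightarrow> I \<rightarrow> 0\<close> of a graded ideal, with
  \<open>F\<^sub>i = \<Oplus>\<^sub>c S(-d i c)\<close> of finite rank \<open>dim_col (A i)\<close>. The matrix of the augmentation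
  \<open>F\<^sub>0 \<rightarrow> I \<subseteq> S\<close> is \<open>A 0\<close>, and that of \<open>F\<^bsub>i+1\<^esub> \<rightarrow> F\<^sub>i\<close> is \<open>A (i + 1)\<close>. The maps are homogeneous of
  degree \<open>0\<close>, so the \<open>(r, c)\<close> entry of \<open>A (i + 1)\<close> is homogeneous of degree
  \<open>d (i + 1) c - d i r\<close>; the condition is written additively, so that the entry is forced to be zero
  if this number is negative. Minimality says that \<open>F\<^bsub>i+1\<^esub>\<close> is mapped into
  \<open>\<langle>x\<^sub>1, \<dots>, x\<^sub>n\<rangle> F\<^sub>i\<close>, i.e. that the entries of \<open>A (i + 1)\<close> have constant coefficient \<open>0\<close>; it imposes
  nothing on \<open>A 0\<close>. Shifts may be taken in \<open>nat\<close>, since the minimal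
  resolution of an ideal of \<open>S\<close> has no negative ones. A resolution of finite length is continued by
  modules of rank \<open>0\<close>.\<close>

definition minimal_graded_free_resolution ::
    "('n::finite, 'k::field) mpoly set \<Rightarrow> (nat \<Rightarrow> ('n, 'k) mpoly mat) \<Rightarrow> (nat \<Rightarrow> nat \<Rightarrow> nat) \<Rightarrow> bool"
where
  "minimal_graded_free_resolution I A d \<longleftrightarrow>
     dim_row (A 0) = 1 \<and>
     (\<forall>i. dim_row (A (Suc i)) = dim_col (A i)) \<and>
     {(A 0 *\<^sub>v u) $ 0 | u. u \<in> carrier_vec (dim_col (A 0))} = I \<and>
     (\<forall>i. mat_kernel (A i) = {A (Suc i) *\<^sub>v u | u. u \<in> carrier_vec (dim_col (A (Suc i)))}) \<and>
     (\<forall>c < dim_col (A 0). A 0 $$ (0, c) \<in> homog (d 0 c)) \<and>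
     (\<forall>i. \<forall>r < dim_col (A i). \<forall>c < dim_col (A (Suc i)).
        \<forall>m \<in> Poly_Mapping.keys (A (Suc i) $$ (r, c)). mon_deg m + d i r = d (Suc i) c) \<and>
     (\<forall>i. \<forall>r < dim_col (A i). \<forall>c < dim_col (A (Suc i)). Poly_Mapping.lookup (A (Suc i) $$ (r, c)) 0 = 0)"

text \<open>\<open>has_regularity I \<rho>\<close> says \<open>reg I = \<rho>\<close>, where \<open>reg I\<close> is the largest \<open>j - i\<close> such that \<open>S(-j)\<close> is a
  summand of the \<open>i\<close>-th module \<open>F\<^sub>i\<close> of the minimal graded free resolution of \<open>I\<close>, i.e. such that
  \<open>\<beta>\<^bsub>i,j\<^esub>(I) \<noteq> 0\<close>. The resolution is unique up to isomorphism, so it does not matter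
  which one is taken.\<close>

definition has_regularity :: "('n::finite, 'k::field) mpoly set \<Rightarrow> int \<Rightarrow> bool" where
  "has_regularity I \<rho> \<longleftrightarrow> (\<exists>A d. minimal_graded_free_resolution I A d \<and>
     (\<exists>i. \<exists>c < dim_col (A i). int (d i c) - int i = \<rho>) \<and>
     (\<forall>i. \<forall>c < dim_col (A i). int (d i c) - int i \<le> \<rho>))"

definition equigenerated :: "('n::finite, 'k::field) mpoly set \<Rightarrow> bool" where
  "equigenerated I \<longleftrightarrow> (\<exists>d. \<exists>B \<subseteq> homog d. I = self_module.span B)"

definition has_linear_resolution :: "('n::finite, 'k::field) mpoly set \<Rightarrow> bool" where
  "has_linear_resolution I \<longleftrightarrow> equigenerated I \<and> has_regularity I (int (alpha I))"


section \<open>Graphs and cover ideals\<close>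

text \<open>A finite simple graph with vertex set \<open>UNIV :: 'n set\<close> is given by its set of edges.\<close>

definition simple_graph :: "'n set set \<Rightarrow> bool" where
  "simple_graph E \<longleftrightarrow> (\<forall>e\<in>E. card e = 2)"

definition vertex_cover :: "'n set set \<Rightarrow> 'n set \<Rightarrow> bool" where
  "vertex_cover E C \<longleftrightarrow> (\<forall>e\<in>E. C \<inter> e \<noteq> {})"

definition minimal_vertex_cover :: "'n set set \<Rightarrow> 'n set \<Rightarrow> bool" where
  "minimal_vertex_cover E C \<longleftrightarrow> vertex_cover E C \<and> (\<forall>D. D \<subset> C \<longrightarrow> \<not> vertex_cover E D)"

definition cover_ideal :: "'n::finite set set \<Rightarrow> ('n, 'k::field) mpoly set" where
  "cover_ideal E = self_module.span {\<Prod>v\<in>C. var v | C. minimal_vertex_cover E C}"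

end

theory Submission
  imports Defs
begin

text \<open>Write \<open>J\<close> for the cover ideal, \<open>\<alpha>\<close> for its initial degree and \<open>x\<^sub>C\<close> for the product of the
  variables in \<open>C\<close>.

  The lower bound holds for every graph with an edge. If \<open>(J\<^sup>k : f)\<close> is a prime, it contains \<open>J\<^sup>k\<close>,
  hence a power \<open>x\<^sub>C\<^sup>k\<close>, hence a variable \<open>v\<close>. Then \<open>v f\<close> is a nonzero element of \<open>J\<^sup>k\<close>, all of whose
  monomials have degree at least \<open>\<alpha> k\<close>, so \<open>deg f \<ge> \<alpha> k - 1\<close> (\<open>v_number_ge\<close>).

  For the upper bound the linear resolution matters only through its first syzygies. It yields a
  set \<open>W\<close> of \<open>\<alpha> - 1\<close> vertices and vertices \<open>x\<close>, \<open>y\<close> such that \<open>W \<union> {x}\<close> and \<open>W \<union> {y}\<close> are vertex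
  covers (\<open>covers_sharing_all_but_one_vertex\<close>). The set \<open>W\<close> is too small to be a cover, and an edge
  that avoids it has to be \<open>{x, y}\<close>. Put \<open>f = x\<^bsub>W \<union> {x}\<^esub>\<^sup>k\<^sup>-\<^sup>1 x\<^sub>W\<close>, which has degree \<open>\<alpha> k - 1\<close>. Both
  \<open>x f\<close> and \<open>y f\<close> are products of \<open>k\<close> cover monomials. Conversely \<open>J \<subseteq> \<langle>x, y\<rangle>\<close>, because every cover
  meets the edge \<open>{x, y}\<close>, so \<open>J\<^sup>k \<subseteq> \<langle>x, y\<rangle>\<^sup>k\<close>, while \<open>f\<close> has order only \<open>k - 1\<close> in \<open>x, y\<close>. Hence
  \<open>(J\<^sup>k : f) = \<langle>x, y\<rangle>\<close> (\<open>colon_ideal_power_eq_edge_prime\<close>).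

  To find \<open>W\<close>, suppose that no two distinct covers of size \<open>\<alpha>\<close> differ by the exchange of a single
  vertex. Then the products \<open>x\<^sub>C v\<close>, for \<open>C\<close> a cover of size \<open>\<alpha>\<close> and \<open>v\<close> a variable, are pairwise
  distinct monomials, so linear syzygies between elements of \<open>J\<^sub>\<alpha>\<close> split into relations with constant
  coefficients, which minimality of the resolution forbids. Linearity of the resolution says that all syzygies come
  from linear ones, so the augmentation is injective and \<open>J\<close> is a free module. The coordinate
  vectors \<open>p\<close>, \<open>q\<close> of two elements \<open>f\<close>, \<open>g\<close> then satisfy the Koszul relation \<open>g p = f q\<close>, which forces
  one of two distinct minimal cover monomials to divide the other, a contradiction (\<open>cover_ideal_exchange_pair\<close>).\<close>


section \<open>Monomials and ideals spanned by monomials\<close>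

lemma lookup_single_mult_shift:
  fixes f :: "('n, 'k::field) mpoly"
  shows "Poly_Mapping.lookup (Poly_Mapping.single m c * f) (m + n) = c * Poly_Mapping.lookup f n"
proof -
  have "Poly_Mapping.lookup (Poly_Mapping.single m c * f) (m + n)
      = Sum_any (\<lambda>l. (c when m = l) * Sum_any (\<lambda>q. Poly_Mapping.lookup f q when m + n = l + q))"
    by (simp add: lookup_mult lookup_single)
  also have "\<dots> = Sum_any (\<lambda>l. c * Sum_any (\<lambda>q. Poly_Mapping.lookup f q when n = q) when l = m)"
    by (rule Sum_any.cong) (auto simp: when_def)
  also have "\<dots> = c * Poly_Mapping.lookup f n"
    by simp
  finally show ?thesis .
qed

lemma keys_single_mult_subset:
  fixes f :: "('n, 'k::field) mpoly"
  shows "Poly_Mapping.keys (Poly_Mapping.single m c * f) \<subseteq> (+) m ` Poly_Mapping.keys f"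
  using keys_mult[of "Poly_Mapping.single m c" f] by (auto split: if_splits)

lemma sum_single_keys:
  fixes f :: "('n, 'k::field) mpoly"
  shows "(\<Sum>m\<in>Poly_Mapping.keys f. Poly_Mapping.single m (Poly_Mapping.lookup f m)) = f"
  by (rule poly_mapping_eqI)
    (auto simp: lookup_sum lookup_single when_def in_keys_iff sum.delta')

text \<open>For a set \<open>U\<close> of exponents that is closed under adding arbitrary exponents, this is the
  monomial ideal with monomials \<open>U\<close>. Membership in it can be read off term by term, which is why
  ideals are compared with such spans below.\<close>

definition monomial_span :: "('n \<Rightarrow>\<^sub>0 nat) set \<Rightarrow> ('n, 'k::field) mpoly set" where
  "monomial_span U = {f. Poly_Mapping.keys f \<subseteq> U}"

lemma subspace_monomial_span:
  assumes "\<And>m n. m \<in> U \<Longrightarrow> n + m \<in> U"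
  shows "self_module.subspace (monomial_span U :: ('n, 'k::field) mpoly set)"
  unfolding self_module.subspace_def
proof (intro conjI ballI allI)
  fix f g :: "('n, 'k) mpoly" assume "f \<in> monomial_span U" "g \<in> monomial_span U"
  then show "f + g \<in> monomial_span U"
    using keys_add[of f g] by (auto simp: monomial_span_def)
next
  fix c f :: "('n, 'k) mpoly" assume "f \<in> monomial_span U"
  then show "c * f \<in> monomial_span U"
    using keys_mult[of c f] assms by (fastforce simp: monomial_span_def)
qed (simp add: monomial_span_def)

lemma monomial_span_subset_ideal:
  assumes "self_module.subspace I"
    and "\<And>m c. m \<in> U \<Longrightarrow> Poly_Mapping.single m c \<in> I"
  shows "(monomial_span U :: ('n, 'k::field) mpoly set) \<subseteq> I"
proof
  fix f :: "('n, 'k) mpoly" assume "f \<in> monomial_span U"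
  then have "(\<Sum>m\<in>Poly_Mapping.keys f. Poly_Mapping.single m (Poly_Mapping.lookup f m)) \<in> I"
    using assms by (intro self_module.subspace_sum) (auto simp: monomial_span_def)
  then show "f \<in> I" by (simp add: sum_single_keys)
qed

definition set_monomial :: "'n set \<Rightarrow> 'n::finite \<Rightarrow>\<^sub>0 nat" where
  "set_monomial C = (\<Sum>v\<in>C. Poly_Mapping.single v 1)"

lemma lookup_set_monomial [simp]:
  "Poly_Mapping.lookup (set_monomial C) v = (if v \<in> C then 1 else 0)"
  by (simp add: set_monomial_def lookup_sum lookup_single when_def)

lemma set_monomial_divides:
  "C \<subseteq> Poly_Mapping.keys m \<Longrightarrow> Poly_Mapping.lookup (set_monomial C) v \<le> Poly_Mapping.lookup m v"
  by (auto simp: in_keys_iff Suc_le_eq)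

lemma prod_var: "(\<Prod>v\<in>C. var v) = (Poly_Mapping.single (set_monomial C) 1 :: ('n::finite, 'k::field) mpoly)"
proof -
  have "finite C" by simp
  then show ?thesis
    by (induction C) (auto simp: set_monomial_def var_def mult_single)
qed

lemma single_power:
  "(Poly_Mapping.single m 1 :: ('n, 'k::field) mpoly) ^ k = Poly_Mapping.single (\<Sum>i<k. m) 1"
  by (induction k) (auto simp: mult_single add.commute)

lemma mon_deg_add: "mon_deg (m + n) = mon_deg m + mon_deg n"
  by (simp add: mon_deg_def lookup_add sum.distrib)

lemma mon_deg_set_monomial [simp]: "mon_deg (set_monomial C) = card C"
  by (simp add: mon_deg_def sum.If_cases)

lemma mon_deg_single [simp]: "mon_deg (Poly_Mapping.single v n) = n"
  by (simp add: mon_deg_def lookup_single when_def)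

lemma mon_deg_sum_const [simp]: "mon_deg (\<Sum>i<(k::nat). m) = k * mon_deg m"
  by (induction k) (auto simp: mon_deg_add, simp add: mon_deg_def)

lemma mon_deg_eq_0_iff: "mon_deg m = 0 \<longleftrightarrow> m = 0"
  by (auto simp: mon_deg_def intro!: poly_mapping_eqI)

lemma mon_deg_eq_1:
  assumes "mon_deg m = 1"
  obtains v where "m = Poly_Mapping.single v 1"
proof -
  obtain v where "Poly_Mapping.lookup m v = 1" "\<forall>u. u \<noteq> v \<longrightarrow> Poly_Mapping.lookup m u = 0"
    using assms unfolding mon_deg_def by (subst (asm) sum_eq_1_iff) auto
  then have "m = Poly_Mapping.single v 1"
    by (intro poly_mapping_eqI) (auto simp: lookup_single when_def)
  then show thesis by (rule that)
qed

lemma monomial_eq_of_divides_same_degree: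
  assumes "\<And>v. Poly_Mapping.lookup m v \<le> Poly_Mapping.lookup n v" "mon_deg n \<le> mon_deg m"
  shows "m = n"
proof (rule ccontr)
  assume "m \<noteq> n"
  then obtain v where "Poly_Mapping.lookup m v \<noteq> Poly_Mapping.lookup n v"
    by (auto simp: poly_mapping_eq_iff fun_eq_iff)
  with assms(1)[of v] have "mon_deg m < mon_deg n"
    unfolding mon_deg_def using assms(1)
    by (intro sum_strict_mono_ex1) (auto intro!: exI[of _ v] order.not_eq_order_implies_strict)
  with assms(2) show False by simp
qed


section \<open>Powers of ideals and prime ideals\<close>

lemma subspace_ideal_power: "self_module.subspace (ideal_power I k)"
  by (cases k) (auto simp: self_module.subspace_UNIV self_module.subspace_span)

lemma subspace_colon:
  assumes "self_module.subspace I"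
  shows "self_module.subspace (colon I f)"
proof (rule self_module.subspaceI)
  show "0 \<in> colon I f"
    using self_module.subspace_0[OF assms] by (simp add: colon_def)
  show "g + h \<in> colon I f" if "g \<in> colon I f" "h \<in> colon I f" for g h
  proof -
    have "g * f + h * f \<in> I"
      by (rule self_module.subspace_add[OF assms]) (use that in \<open>simp_all add: colon_def\<close>)
    then show ?thesis by (simp only: colon_def mem_Collect_eq distrib_right)
  qed
  show "c * g \<in> colon I f" if "g \<in> colon I f" for c g
  proof -
    have "c * (g * f) \<in> I"
      by (rule self_module.subspace_scale[OF assms]) (use that in \<open>simp add: colon_def\<close>)
    then show ?thesis by (simp only: colon_def mem_Collect_eq mult.assoc)
  qed
qed

lemma mult_in_ideal_power_Suc:
  "a \<in> I \<Longrightarrow> b \<in> ideal_power I k \<Longrightarrow> a * b \<in> ideal_power I (Suc k)"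
  by (auto intro: self_module.span_base)

lemma power_in_ideal_power: "a \<in> I \<Longrightarrow> a ^ k \<in> ideal_power I k"
proof (induction k)
  case (Suc k)
  then show ?case
    using mult_in_ideal_power_Suc[of a I "a ^ k" k] by (simp del: ideal_power.simps)
qed simp

text \<open>The order of vanishing of a power of an ideal grows linearly, for every grading by an additive weight.
  The weights used below are the total degree and the joint degree in the two ends of an edge.\<close>

lemma weight_of_keys_ideal_power:
  fixes L :: "('n \<Rightarrow>\<^sub>0 nat) \<Rightarrow> nat" and f :: "('n, 'k::field) mpoly"
  assumes L_add: "\<And>m n. L (m + n) = L m + L n"
    and I: "\<And>f m. f \<in> I \<Longrightarrow> m \<in> Poly_Mapping.keys f \<Longrightarrow> a \<le> L m"
    and "f \<in> ideal_power I k" "m \<in> Poly_Mapping.keys f"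
  shows "a * k \<le> L m"
proof -
  have "ideal_power I k \<subseteq> monomial_span {m. a * k \<le> L m}"
  proof (induction k)
    case (Suc k)
    have "{g * h | g h. g \<in> I \<and> h \<in> ideal_power I k} \<subseteq> monomial_span {m. a * Suc k \<le> L m}"
    proof
      fix p assume "p \<in> {g * h | g h. g \<in> I \<and> h \<in> ideal_power I k}"
      then obtain g h where p: "p = g * h" and g: "g \<in> I" and h: "h \<in> ideal_power I k"
        by auto
      have "a * Suc k \<le> L m" if m: "m \<in> Poly_Mapping.keys p" for m
      proof -
        obtain m1 m2 where m12: "m = m1 + m2" "m1 \<in> Poly_Mapping.keys g" "m2 \<in> Poly_Mapping.keys h"
          using m keys_mult[of g h] unfolding p by auto
        then have "a \<le> L m1" "a * k \<le> L m2"
          using I g h Suc.IH by (auto simp: monomial_span_def)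
        then show ?thesis by (simp add: m12 L_add)
      qed
      then show "p \<in> monomial_span {m. a * Suc k \<le> L m}"
        by (auto simp: monomial_span_def)
    qed
    then show ?case
      by (simp del: mult_Suc_right)
        (intro self_module.span_minimal subspace_monomial_span, auto simp: L_add)
  qed (simp add: monomial_span_def)
  then show ?thesis using assms(3,4) by (auto simp: monomial_span_def)
qed

lemma prime_ideal_prod:
  assumes "prime_ideal P" "finite C" "prod h C \<in> P"
  obtains v where "v \<in> C" "h v \<in> P"
proof -
  have "prod h C \<in> P \<longrightarrow> (\<exists>v\<in>C. h v \<in> P)"
    using assms(2)
  proof (induction C)
    case empty
    have "1 \<notin> P"
    proof
      assume "1 \<in> P"
      then have "x \<in> P" for x
        using self_module.subspace_scale[of P 1 x] assms(1) by (simp add: prime_ideal_def)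
      then show False using assms(1) by (auto simp: prime_ideal_def)
    qed
    then show ?case by simp
  next
    case (insert v C)
    then show ?case using assms(1) by (auto simp: prime_ideal_def)
  qed
  then show thesis using assms(3) that by blast
qed

lemma prime_ideal_power:
  assumes "prime_ideal P" "a ^ k \<in> P"
  shows "a \<in> P"
  using prime_ideal_prod[of P "{..<k}" "\<lambda>_. a"] assms by auto

text \<open>The exponents in \<open>nat \<Rightarrow>\<^sub>0 nat\<close> are linearly ordered compatibly with addition. Numbering the
  variables transports this to a monomial order on the exponents in an unordered set of variables.\<close>

lemma monomial_embedding:
  obtains \<omega> :: "('n::finite \<Rightarrow>\<^sub>0 nat) \<Rightarrow> (nat \<Rightarrow>\<^sub>0 nat)"
  where "inj \<omega>" "\<And>m n. \<omega> (m + n) = \<omega> m + \<omega> n"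
proof -
  obtain e :: "'n \<Rightarrow> nat" where e: "inj e"
    using finite_imp_inj_to_nat_seg[of "UNIV :: 'n set"] by auto
  define \<omega> :: "('n \<Rightarrow>\<^sub>0 nat) \<Rightarrow> (nat \<Rightarrow>\<^sub>0 nat)"
    where "\<omega> m = (\<Sum>v\<in>UNIV. Poly_Mapping.single (e v) (Poly_Mapping.lookup m v))" for m
  have lk: "Poly_Mapping.lookup (\<omega> m) (e v) = Poly_Mapping.lookup m v" for m v
    using e by (simp add: \<omega>_def lookup_sum lookup_single when_def inj_eq)
  show thesis
  proof
    show "inj \<omega>"
      by (rule injI, rule poly_mapping_eqI) (metis lk)
    show "\<omega> (m + n) = \<omega> m + \<omega> n" for m n
      by (simp add: \<omega>_def lookup_add single_add sum.distrib)
  qed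
qed

text \<open>The ideal generated by the variables in \<open>V\<close> is prime because the remaining variables generate a domain:
  for \<open>f\<close> and \<open>g\<close> outside the ideal, take the leading monomials of the parts of \<open>f\<close> and
  \<open>g\<close> free of \<open>V\<close>. Their product cannot cancel in \<open>f g\<close>.\<close>

lemma prime_ideal_vars:
  "prime_ideal (monomial_span {m. \<exists>v\<in>V. Poly_Mapping.lookup m v \<noteq> 0} :: ('n::finite, 'k::field) mpoly set)"
    (is "prime_ideal ?P")
  unfolding prime_ideal_def
proof (intro conjI allI impI)
  show "self_module.subspace ?P"
    by (rule subspace_monomial_span) (auto simp: lookup_add)
  have "1 \<notin> ?P" by (auto simp: monomial_span_def)
  then show "?P \<noteq> UNIV" by blast
  fix f g :: "('n, 'k) mpoly"
  assume fg: "f * g \<in> ?P"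
  obtain \<omega> :: "('n \<Rightarrow>\<^sub>0 nat) \<Rightarrow> (nat \<Rightarrow>\<^sub>0 nat)"
    where \<omega>: "inj \<omega>" "\<And>m n. \<omega> (m + n) = \<omega> m + \<omega> n"
    by (rule monomial_embedding) blast
  define R where "R h = {m \<in> Poly_Mapping.keys h. \<forall>v\<in>V. Poly_Mapping.lookup m v = 0}"
    for h :: "('n, 'k) mpoly"
  have lead: "\<exists>m\<in>R h. \<forall>n\<in>R h. \<omega> n \<le> \<omega> m" if "h \<notin> ?P" for h
  proof -
    have "finite (\<omega> ` R h)" "\<omega> ` R h \<noteq> {}"
      using that by (auto simp: R_def monomial_span_def)
    then show ?thesis
      using Max_in[of "\<omega> ` R h"] Max_ge[of "\<omega> ` R h"] by (metis imageE imageI)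
  qed
  show "f \<in> ?P \<or> g \<in> ?P"
  proof (rule ccontr)
    assume "\<not> (f \<in> ?P \<or> g \<in> ?P)"
    then obtain m n where m: "m \<in> R f" "\<And>m'. m' \<in> R f \<Longrightarrow> \<omega> m' \<le> \<omega> m"
      and n: "n \<in> R g" "\<And>n'. n' \<in> R g \<Longrightarrow> \<omega> n' \<le> \<omega> n"
      using lead by meson
    have unique: "m' = m \<and> n' = n"
      if "m' \<in> Poly_Mapping.keys f" "n' \<in> Poly_Mapping.keys g" "m + n = m' + n'" for m' n'
    proof -
      have "Poly_Mapping.lookup m' v = 0 \<and> Poly_Mapping.lookup n' v = 0" if "v \<in> V" for v
        using m(1) n(1) that arg_cong[OF \<open>m + n = m' + n'\<close>, of "\<lambda>p. Poly_Mapping.lookup p v"]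
        by (simp add: R_def lookup_add)
      then have "m' \<in> R f" "n' \<in> R g" using that by (auto simp: R_def)
      then have le: "\<omega> m' \<le> \<omega> m" "\<omega> n' \<le> \<omega> n" using m n by auto
      have "\<omega> m' + \<omega> n' = \<omega> m + \<omega> n" using that(3) \<omega>(2) by metis
      then have "\<omega> m' = \<omega> m"
        using le by (metis add_le_cancel_left add_le_cancel_right antisym)
      then show ?thesis using \<omega>(1) that(3) by (auto simp: inj_eq)
    qed
    have "Poly_Mapping.lookup (f * g) (m + n)
        = Poly_Mapping.lookup ((\<Sum>m'\<in>Poly_Mapping.keys f.
            Poly_Mapping.single m' (Poly_Mapping.lookup f m')) * g) (m + n)"
      by (simp add: sum_single_keys)
    also have "\<dots> = (\<Sum>m'\<in>Poly_Mapping.keys f. Poly_Mapping.lookup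
        (Poly_Mapping.single m' (Poly_Mapping.lookup f m') * g) (m + n))"
      by (simp add: sum_distrib_right lookup_sum)
    also have "\<dots> = (\<Sum>m'\<in>{m}. Poly_Mapping.lookup
        (Poly_Mapping.single m' (Poly_Mapping.lookup f m') * g) (m + n))"
    proof (rule sum.mono_neutral_right)
      show "\<forall>m'\<in>Poly_Mapping.keys f - {m}. Poly_Mapping.lookup
        (Poly_Mapping.single m' (Poly_Mapping.lookup f m') * g) (m + n) = 0"
      proof
        fix m' assume m': "m' \<in> Poly_Mapping.keys f - {m}"
        then have "m + n \<notin> (+) m' ` Poly_Mapping.keys g" using unique by blast
        then show "Poly_Mapping.lookup
          (Poly_Mapping.single m' (Poly_Mapping.lookup f m') * g) (m + n) = 0"
          using keys_single_mult_subset by (metis in_keys_iff subsetD)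
      qed
    qed (use m in \<open>auto simp: R_def\<close>)
    also have "\<dots> = Poly_Mapping.lookup f m * Poly_Mapping.lookup g n"
      by (simp add: lookup_single_mult_shift)
    finally have "m + n \<in> Poly_Mapping.keys (f * g)"
      using m(1) n(1) by (simp add: R_def in_keys_iff)
    then show False
      using fg m(1) n(1) by (auto simp: monomial_span_def R_def lookup_add)
  qed
qed


section \<open>Monomials in cover ideals\<close>

lemma minimal_vertex_cover_subset:
  fixes C :: "'n::finite set"
  assumes "vertex_cover E C"
  obtains D where "D \<subseteq> C" "minimal_vertex_cover E D"
proof -
  have "finite {D. D \<subseteq> C \<and> vertex_cover E D}" by simp
  from finite_has_minimal2[OF this, of C] assms
  obtain D where "D \<subseteq> C" "vertex_cover E D"
    "\<And>D'. D' \<subseteq> C \<Longrightarrow> vertex_cover E D' \<Longrightarrow> D' \<subseteq> D \<Longrightarrow> D = D'"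
    by auto
  then have "minimal_vertex_cover E D"
    unfolding minimal_vertex_cover_def by (metis psubset_eq subset_trans)
  then show thesis using \<open>D \<subseteq> C\<close> that by blast
qed

lemma subspace_cover_ideal: "self_module.subspace (cover_ideal E)"
  by (simp add: cover_ideal_def self_module.subspace_span)

lemma minimal_cover_in_cover_ideal:
  assumes "minimal_vertex_cover E C"
  shows "(Poly_Mapping.single (set_monomial C) 1 :: ('n::finite, 'k::field) mpoly) \<in> cover_ideal E"
  unfolding cover_ideal_def using assms
  by (intro self_module.span_base) (auto simp: prod_var[symmetric])

lemma cover_in_cover_ideal:
  assumes "vertex_cover E C"
  shows "(Poly_Mapping.single (set_monomial C) 1 :: ('n::finite, 'k::field) mpoly) \<in> cover_ideal E"
proof -
  obtain D where D: "D \<subseteq> C" "minimal_vertex_cover E D"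
    using minimal_vertex_cover_subset[OF assms] .
  have "set_monomial C = set_monomial (C - D) + set_monomial D"
    using D(1) by (intro poly_mapping_eqI) (auto simp: lookup_add)
  then have "(Poly_Mapping.single (set_monomial C) 1 :: ('n, 'k) mpoly)
      = Poly_Mapping.single (set_monomial (C - D)) 1 * Poly_Mapping.single (set_monomial D) 1"
    by (simp add: mult_single)
  then show ?thesis
    using self_module.subspace_scale[OF subspace_cover_ideal minimal_cover_in_cover_ideal[OF D(2)]]
    by simp
qed

text \<open>The support of an exponent is its set of keys, so \<open>C \<subseteq> keys m\<close> says that \<open>x\<^sub>C\<close>
  divides the monomial with exponent \<open>m\<close>.\<close>

lemma key_of_cover_ideal:
  fixes f :: "('n::finite, 'k::field) mpoly"
  assumes "f \<in> cover_ideal E" "m \<in> Poly_Mapping.keys f"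
  obtains C where "minimal_vertex_cover E C" "C \<subseteq> Poly_Mapping.keys m"
proof -
  let ?U = "{m. \<exists>C. minimal_vertex_cover E C \<and> C \<subseteq> Poly_Mapping.keys m}"
  have "cover_ideal E \<subseteq> (monomial_span ?U :: ('n, 'k) mpoly set)"
    unfolding cover_ideal_def
  proof (rule self_module.span_minimal)
    show "{\<Prod>v\<in>C. var v |C. minimal_vertex_cover E C} \<subseteq> (monomial_span ?U :: ('n, 'k) mpoly set)"
      by (auto simp: prod_var monomial_span_def in_keys_iff)
    have "Poly_Mapping.keys m \<subseteq> Poly_Mapping.keys (n + m)" for m n :: "'n \<Rightarrow>\<^sub>0 nat"
      by (auto simp: in_keys_iff lookup_add)
    then show "self_module.subspace (monomial_span ?U :: ('n, 'k) mpoly set)"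
      by (intro subspace_monomial_span) blast
  qed
  then show thesis using assms that by (auto simp: monomial_span_def)
qed

lemma alpha_le_card_cover:
  assumes "vertex_cover E C"
  shows "alpha (cover_ideal E :: ('n::finite, 'k::field) mpoly set) \<le> card C"
  unfolding alpha_def
proof (rule Least_le)
  show "\<exists>f\<in>cover_ideal E. (f :: ('n, 'k) mpoly) \<noteq> 0 \<and> f \<in> homog (card C)"
  proof (intro bexI conjI)
    let ?f = "Poly_Mapping.single (set_monomial C) 1 :: ('n, 'k) mpoly"
    show "?f \<in> cover_ideal E" using cover_in_cover_ideal[OF assms] .
    have "Poly_Mapping.keys ?f \<noteq> {}" by simp
    then show "?f \<noteq> 0" by fastforce
    show "?f \<in> homog (card C)" by (simp add: homog_def)
  qed
qed

lemma alpha_le_deg_key_of_cover_ideal: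
  fixes f :: "('n::finite, 'k::field) mpoly"
  assumes "f \<in> cover_ideal E" "m \<in> Poly_Mapping.keys f"
  shows "alpha (cover_ideal E :: ('n, 'k) mpoly set) \<le> mon_deg m"
proof -
  obtain C where C: "minimal_vertex_cover E C" "C \<subseteq> Poly_Mapping.keys m"
    using key_of_cover_ideal[OF assms] .
  have "alpha (cover_ideal E :: ('n, 'k) mpoly set) \<le> mon_deg (set_monomial C)"
    using C(1) alpha_le_card_cover by (auto simp: minimal_vertex_cover_def)
  also have "\<dots> \<le> mon_deg m"
    unfolding mon_deg_def by (intro sum_mono set_monomial_divides C(2))
  finally show ?thesis .
qed

lemma key_of_degree_alpha:
  fixes f :: "('n::finite, 'k::field) mpoly"
  assumes "f \<in> cover_ideal E" "m \<in> Poly_Mapping.keys f"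
    and "mon_deg m = alpha (cover_ideal E :: ('n, 'k) mpoly set)"
  obtains C where "minimal_vertex_cover E C" "m = set_monomial C"
proof -
  obtain C where C: "minimal_vertex_cover E C" "C \<subseteq> Poly_Mapping.keys m"
    using key_of_cover_ideal[OF assms(1,2)] .
  have "mon_deg m \<le> mon_deg (set_monomial C)"
    using C(1) alpha_le_card_cover assms(3) by (auto simp: minimal_vertex_cover_def)
  then have "set_monomial C = m"
    using monomial_eq_of_divides_same_degree set_monomial_divides[OF C(2)] by blast
  then show thesis using C(1) that by blast
qed

text \<open>For an edge \<open>{x, y}\<close>, the complements of \<open>{x}\<close> and of \<open>{y}\<close> are covers. A minimal cover
  inside the first contains \<open>y\<close>, one inside the second does not.\<close>

lemma two_minimal_covers:
  fixes E :: "'n::finite set set"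
  assumes "simple_graph E" "E \<noteq> {}"
  obtains C D where "minimal_vertex_cover E C" "minimal_vertex_cover E D" "C \<noteq> D"
proof -
  obtain e where e: "e \<in> E" using assms(2) by blast
  then obtain x y where xy: "e = {x, y}" "x \<noteq> y"
    using assms(1) by (auto simp: simple_graph_def card_2_iff)
  have "vertex_cover E (- {v})" for v
  proof -
    have False if "d \<in> E" "- {v} \<inter> d = {}" for d
    proof -
      have "card d \<le> card {v}" using that by (intro card_mono) auto
      then show False using that assms(1) by (auto simp: simple_graph_def)
    qed
    then show ?thesis by (auto simp: vertex_cover_def)
  qed
  then obtain C D where CD: "minimal_vertex_cover E C" "C \<subseteq> - {x}"
    "minimal_vertex_cover E D" "D \<subseteq> - {y}"
    by (metis minimal_vertex_cover_subset)
  have "C \<inter> e \<noteq> {}"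
    using CD(1) e by (auto simp: minimal_vertex_cover_def vertex_cover_def)
  then have "y \<in> C" using CD(2) xy by auto
  then show thesis using CD that by blast
qed


section \<open>Linear syzygies\<close>

text \<open>By \<open>no_exchange\<close>, a product of a variable and a monomial of some \<open>a r\<close> determines both factors.
  The part of a linear syzygy that involves a given variable \<open>x\<close> thus has to vanish by itself.\<close>

lemma linear_syzygy_coefficients:
  fixes a w :: "nat \<Rightarrow> ('n::finite, 'k::field) mpoly"
  assumes no_exchange: "\<And>r s u u' x y. r < N \<Longrightarrow> s < N \<Longrightarrow> u \<in> Poly_Mapping.keys (a r) \<Longrightarrow>
      u' \<in> Poly_Mapping.keys (a s) \<Longrightarrow> x \<noteq> y \<Longrightarrow>
      u + Poly_Mapping.single x 1 \<noteq> u' + Poly_Mapping.single y 1"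
    and linear: "\<And>r. r < N \<Longrightarrow> Poly_Mapping.keys (w r) \<subseteq> range (\<lambda>x. Poly_Mapping.single x 1)"
    and syzygy: "(\<Sum>r<N. a r * w r) = 0"
  shows "(\<Sum>r<N. a r * Poly_Mapping.single 0 (Poly_Mapping.lookup (w r) (Poly_Mapping.single x 1))) = 0"
    (is "?s = 0")
proof (rule poly_mapping_eqI)
  fix u
  let ?X = "\<lambda>y::'n. Poly_Mapping.single y (1::nat)"
  let ?l = "\<lambda>r y. Poly_Mapping.lookup (w r) (?X y)"
  have const: "Poly_Mapping.lookup (Poly_Mapping.single 0 c * f) u = c * Poly_Mapping.lookup f u"
    for c and f :: "('n, 'k) mpoly"
    using lookup_single_mult_shift[of 0 c f u] by simp
  have coeff: "Poly_Mapping.lookup ?s u = (\<Sum>r<N. ?l r x * Poly_Mapping.lookup (a r) u)"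
    by (simp add: lookup_sum mult.commute[of "a _"] const del: One_nat_def)
  show "Poly_Mapping.lookup ?s u = Poly_Mapping.lookup 0 u"
  proof (cases "\<exists>r<N. u \<in> Poly_Mapping.keys (a r)")
    case False
    then show ?thesis unfolding coeff by (simp add: in_keys_iff)
  next
    case True
    then obtain s where s: "s < N" "u \<in> Poly_Mapping.keys (a s)" by blast
    have "Poly_Mapping.lookup (a r * w r) (?X x + u) = ?l r x * Poly_Mapping.lookup (a r) u"
      if r: "r < N" for r
    proof -
      have "inj ?X" by (rule injI) (metis lookup_single_eq lookup_single_not_eq one_neq_zero)
      have w: "w r = (\<Sum>y\<in>UNIV. Poly_Mapping.single (?X y) (?l r y))"
      proof -
        have "w r = (\<Sum>m\<in>range ?X. Poly_Mapping.single m (Poly_Mapping.lookup (w r) m))"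
          by (subst sum_single_keys[of "w r", symmetric], rule sum.mono_neutral_left)
            (use linear[OF r] in \<open>auto simp: in_keys_iff\<close>)
        also have "\<dots> = (\<Sum>y\<in>UNIV. Poly_Mapping.single (?X y) (?l r y))"
          by (subst sum.reindex[OF \<open>inj ?X\<close>]) simp
        finally show ?thesis .
      qed
      have other: "Poly_Mapping.lookup (Poly_Mapping.single (?X y) (?l r y) * a r) (?X x + u) = 0"
        if "y \<noteq> x" for y
      proof (rule ccontr)
        assume "\<not> ?thesis"
        then have "?X x + u \<in> (+) (?X y) ` Poly_Mapping.keys (a r)"
          using keys_single_mult_subset by (metis in_keys_iff subsetD)
        then obtain u' where "u' \<in> Poly_Mapping.keys (a r)" "u + ?X x = u' + ?X y"
          by (auto simp: add.commute)
        then show False using no_exchange[OF s(1) r s(2)] that by metis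
      qed
      have "a r * w r = (\<Sum>y\<in>UNIV. Poly_Mapping.single (?X y) (?l r y) * a r)"
        by (subst w) (simp add: sum_distrib_left mult.commute[of _ "a r"])
      then have "Poly_Mapping.lookup (a r * w r) (?X x + u)
          = (\<Sum>y\<in>UNIV. Poly_Mapping.lookup (Poly_Mapping.single (?X y) (?l r y) * a r) (?X x + u))"
        by (simp add: lookup_sum)
      also have "\<dots> = (\<Sum>y\<in>{x}. Poly_Mapping.lookup (Poly_Mapping.single (?X y) (?l r y) * a r) (?X x + u))"
        by (rule sum.mono_neutral_right) (use other in auto)
      also have "\<dots> = ?l r x * Poly_Mapping.lookup (a r) u"
        by (simp add: lookup_single_mult_shift)
      finally show ?thesis .
    qed
    then have "Poly_Mapping.lookup ?s u = Poly_Mapping.lookup (\<Sum>r<N. a r * w r) (?X x + u)"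
      unfolding coeff by (simp add: lookup_sum)
    then show ?thesis unfolding syzygy by (simp only: lookup_zero)
  qed
qed

text \<open>Minimality of a resolution is a condition on the entries of its matrices; it passes to
  their images because the polynomials without constant term form an ideal. In particular, the
  generators are linearly independent over the field.\<close>

lemma minimal_resolution_kernel_no_constants:
  assumes "minimal_graded_free_resolution I A d" "w \<in> mat_kernel (A 0)" "r < dim_col (A 0)"
  shows "Poly_Mapping.lookup (w $ r) 0 = (0 :: 'k::field)"
proof -
  obtain u where u: "u \<in> carrier_vec (dim_col (A (Suc 0)))" "w = A (Suc 0) *\<^sub>v u"
    using assms(1,2) by (auto simp: minimal_graded_free_resolution_def)
  have dr: "dim_row (A (Suc 0)) = dim_col (A 0)"
    and c0: "\<And>c. c < dim_col (A (Suc 0)) \<Longrightarrow> Poly_Mapping.lookup (A (Suc 0) $$ (r, c)) 0 = 0"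
    using assms(1,3) by (auto simp: minimal_graded_free_resolution_def)
  have lk0: "Poly_Mapping.lookup (p * q) 0 = 0" if "Poly_Mapping.lookup p 0 = 0"
    for p q :: "('n, 'k) mpoly"
  proof -
    have "0 \<notin> Poly_Mapping.keys (p * q)"
    proof
      assume "0 \<in> Poly_Mapping.keys (p * q)"
      then obtain m n where mn: "0 = m + n" "m \<in> Poly_Mapping.keys p"
        using keys_mult[of p q] by blast
      have "m = 0"
      proof (rule poly_mapping_eqI)
        fix v show "Poly_Mapping.lookup m v = Poly_Mapping.lookup 0 v"
          using arg_cong[OF mn(1), of "\<lambda>p. Poly_Mapping.lookup p v"] by (simp add: lookup_add)
      qed
      then show False using mn(2) that by (simp add: in_keys_iff)
    qed
    then show ?thesis by (simp add: in_keys_iff)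
  qed
  have "w $ r = (\<Sum>c = 0..<dim_col (A (Suc 0)). A (Suc 0) $$ (r, c) * u $ c)"
    using u dr assms(3) by (simp add: scalar_prod_def)
  moreover have "Poly_Mapping.lookup (A (Suc 0) $$ (r, c) * u $ c) 0 = 0" if "c < dim_col (A (Suc 0))" for c
    using lk0 c0 that by blast
  ultimately show ?thesis by (simp add: lookup_sum)
qed

text \<open>If there were no such pair, the augmentation of a linear resolution would be injective, which is
  impossible for an ideal with two incomparable generators.\<close>

lemma cover_ideal_exchange_pair:
  fixes E :: "'n::finite set set"
  assumes "simple_graph E" "E \<noteq> {}"
    and "has_linear_resolution (cover_ideal E :: ('n, 'k::field) mpoly set)"
  obtains C D x y where "minimal_vertex_cover E C" "minimal_vertex_cover E D"
    "card C = alpha (cover_ideal E :: ('n, 'k) mpoly set)" "x \<noteq> y"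
    "set_monomial C + Poly_Mapping.single x 1 = set_monomial D + Poly_Mapping.single y 1"
proof (rule ccontr)
  note that' = that
  define J where "J = (cover_ideal E :: ('n, 'k) mpoly set)"
  define \<alpha> where "\<alpha> = alpha J"
  assume "\<not> thesis"
  then have no_pair: False if "minimal_vertex_cover E C" "minimal_vertex_cover E D"
      "card C = \<alpha>" "x \<noteq> y"
      "set_monomial C + Poly_Mapping.single x 1 = set_monomial D + Poly_Mapping.single y 1"
    for C D x y
    using that that'[of C D x y] by (auto simp: \<alpha>_def J_def)
  obtain A d where res: "minimal_graded_free_resolution J A d"
    and reg: "\<And>i c. c < dim_col (A i) \<Longrightarrow> int (d i c) - int i \<le> int \<alpha>"
    using assms(3) unfolding has_linear_resolution_def has_regularity_def J_def \<alpha>_def by blast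
  define N where "N = dim_col (A 0)"
  define a where "a r = A 0 $$ (0, r)" for r
  have dim0: "dim_row (A 0) = 1" and dim1: "dim_row (A (Suc 0)) = N"
    using res by (auto simp: minimal_graded_free_resolution_def N_def)
  have image: "{(A 0 *\<^sub>v u) $ 0 | u. u \<in> carrier_vec N} = J"
    using res unfolding minimal_graded_free_resolution_def N_def by blast
  have apply0: "(A 0 *\<^sub>v u) $ 0 = (\<Sum>r<N. a r * u $ r)" if "u \<in> carrier_vec N" for u
    using that dim0 by (auto simp: scalar_prod_def a_def N_def lessThan_atLeast0 intro!: sum.cong)
  have kernel: "u \<in> mat_kernel (A 0) \<longleftrightarrow> (\<Sum>r<N. a r * u $ r) = 0" if "u \<in> carrier_vec N" for u
  proof -
    have "u \<in> mat_kernel (A 0) \<longleftrightarrow> A 0 *\<^sub>v u = 0\<^sub>v 1"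
      using that dim0 by (simp add: mat_kernel_def N_def)
    also have "\<dots> \<longleftrightarrow> (A 0 *\<^sub>v u) $ 0 = 0"
      using dim0 by (auto simp: vec_eq_iff simp del: index_mult_mat_vec)
    finally show ?thesis using apply0[OF that] by simp
  qed
  have kernel_const: "Poly_Mapping.lookup (u $ r) 0 = 0"
    if "u \<in> carrier_vec N" "(\<Sum>r<N. a r * u $ r) = 0" "r < N" for u r
    using minimal_resolution_kernel_no_constants[OF res, of u r] that kernel by (simp add: N_def)
  have unit_sum: "(\<Sum>s<N. a s * unit_vec N r $ s) = a r" if "r < N" for r
  proof -
    have "(\<Sum>s<N. a s * unit_vec N r $ s) = (\<Sum>s<N. if s = r then a s else 0)"
      by (rule sum.cong) (auto simp: that)
    then show ?thesis using that by simp
  qed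
  have a_in: "a r \<in> J" if "r < N" for r
  proof -
    have "(A 0 *\<^sub>v unit_vec N r) $ 0 = a r" using apply0 unit_sum[OF that] by simp
    then show ?thesis using image by (metis (mono_tags, lifting) mem_Collect_eq unit_vec_carrier)
  qed
  \<comment> \<open>A zero generator would make the unit vector a syzygy with a constant entry.\<close>
  have a_nz: "a r \<noteq> 0" if "r < N" for r
    using kernel_const[of "unit_vec N r" r] unit_sum[OF that] that by auto
  have d0: "d 0 r = \<alpha>" and a_deg: "\<And>m. m \<in> Poly_Mapping.keys (a r) \<Longrightarrow> mon_deg m = \<alpha>"
    if r: "r < N" for r
  proof -
    have deg: "mon_deg m = d 0 r" if "m \<in> Poly_Mapping.keys (a r)" for m
      using res r that by (auto simp: minimal_graded_free_resolution_def homog_def a_def N_def)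
    obtain m where m: "m \<in> Poly_Mapping.keys (a r)" using a_nz[OF r] by fastforce
    have "\<alpha> \<le> mon_deg m"
      using alpha_le_deg_key_of_cover_ideal a_in[OF r] m by (auto simp: \<alpha>_def J_def)
    moreover have "d 0 r \<le> \<alpha>" using reg[of r 0] r by (simp add: N_def)
    ultimately show "d 0 r = \<alpha>" using deg m by simp
    then show "\<And>m. m \<in> Poly_Mapping.keys (a r) \<Longrightarrow> mon_deg m = \<alpha>" using deg by simp
  qed
  have a_cover: "\<exists>C. minimal_vertex_cover E C \<and> m = set_monomial C \<and> card C = \<alpha>"
    if "r < N" "m \<in> Poly_Mapping.keys (a r)" for r m
    using key_of_degree_alpha[of "a r" E m] a_in[OF that(1)] a_deg[OF that] that(2)
    by (metis J_def \<alpha>_def mon_deg_set_monomial)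
  have no_exchange: "u + Poly_Mapping.single x 1 \<noteq> u' + Poly_Mapping.single y 1"
    if "r < N" "s < N" "u \<in> Poly_Mapping.keys (a r)" "u' \<in> Poly_Mapping.keys (a s)" "x \<noteq> y"
    for r s u u' x y
    using a_cover[OF that(1,3)] a_cover[OF that(2,4)] no_pair that(5) by metis
  \<comment> \<open>The entries of the first syzygies have degree at most \<open>1\<close> by linearity and no constant term by
     minimality, so they are linear forms; splitting them by variables gives constant syzygies.\<close>
  have A1_zero: "A (Suc 0) $$ (r, c) = 0" if r: "r < N" and c: "c < dim_col (A (Suc 0))" for r c
  proof -
    let ?w = "col (A (Suc 0)) c"
    have w: "?w \<in> carrier_vec N" using dim1 by auto
    have "?w = A (Suc 0) *\<^sub>v unit_vec (dim_col (A (Suc 0))) c"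
    proof (rule eq_vecI)
      show "?w $ i = (A (Suc 0) *\<^sub>v unit_vec (dim_col (A (Suc 0))) c) $ i"
        if "i < dim_vec (A (Suc 0) *\<^sub>v unit_vec (dim_col (A (Suc 0))) c)" for i
        using that c by (simp add: scalar_prod_right_unit)
    qed simp
    then have "?w \<in> mat_kernel (A 0)"
      using res c unfolding minimal_graded_free_resolution_def
      by (metis (mono_tags, lifting) One_nat_def mem_Collect_eq unit_vec_carrier)
    then have syz: "(\<Sum>r<N. a r * ?w $ r) = 0" using kernel[OF w] by simp
    have lin: "Poly_Mapping.keys (?w $ r) \<subseteq> range (\<lambda>x. Poly_Mapping.single x 1)" if r: "r < N" for r
    proof
      fix m assume "m \<in> Poly_Mapping.keys (?w $ r)"
      then have m: "m \<in> Poly_Mapping.keys (A (Suc 0) $$ (r, c))" using r c dim1 by simp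
      then have "mon_deg m + d 0 r = d (Suc 0) c"
        using res r c by (auto simp: minimal_graded_free_resolution_def N_def)
      then have "mon_deg m \<le> 1" using reg[OF c] d0[OF r] by simp
      moreover have "m \<noteq> 0"
        using res r c m by (auto simp: minimal_graded_free_resolution_def N_def in_keys_iff)
      ultimately have "mon_deg m = 1" using mon_deg_eq_0_iff[of m] by linarith
      then show "m \<in> range (\<lambda>x. Poly_Mapping.single x 1)" by (metis mon_deg_eq_1 rangeI)
    qed
    have "Poly_Mapping.lookup (?w $ r) (Poly_Mapping.single x 1) = 0" for x
    proof -
      let ?u = "vec N (\<lambda>r. Poly_Mapping.single 0
        (Poly_Mapping.lookup (?w $ r) (Poly_Mapping.single x 1)))"
      have "(\<Sum>r<N. a r * ?u $ r) = 0"
        using linear_syzygy_coefficients[OF no_exchange lin syz, where x = x] by simp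
      then show ?thesis using kernel_const[of ?u r] r by simp
    qed
    then have "m \<notin> Poly_Mapping.keys (?w $ r)" for m
      using lin[OF r] by (metis in_keys_iff rangeE subsetD)
    then have "?w $ r = 0"
      by (intro poly_mapping_eqI) (simp only: in_keys_iff lookup_zero not_not)
    moreover have "?w $ r = A (Suc 0) $$ (r, c)" using r c dim1 by (intro index_col) simp_all
    ultimately show ?thesis by (simp only:)
  qed
  have kernel_zero: "u $ r = 0"
    if u: "u \<in> carrier_vec N" "(\<Sum>r<N. a r * u $ r) = 0" and r: "r < N" for u r
  proof -
    have "u \<in> mat_kernel (A 0)" using kernel u by simp
    then obtain z where z: "z \<in> carrier_vec (dim_col (A (Suc 0)))" "u = A (Suc 0) *\<^sub>v z"
      using res by (auto simp: minimal_graded_free_resolution_def)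
    then show ?thesis using r dim1 A1_zero by (simp add: scalar_prod_def)
  qed
  obtain C D where C: "minimal_vertex_cover E C" and D: "minimal_vertex_cover E D" and "C \<noteq> D"
    using two_minimal_covers[OF assms(1,2)] .
  let ?f = "Poly_Mapping.single (set_monomial C) 1 :: ('n, 'k) mpoly"
  let ?g = "Poly_Mapping.single (set_monomial D) 1 :: ('n, 'k) mpoly"
  have "?f \<in> J" "?g \<in> J"
    using minimal_cover_in_cover_ideal C D by (auto simp: J_def)
  then obtain p q where p: "p \<in> carrier_vec N" "?f = (\<Sum>r<N. a r * p $ r)"
    and q: "q \<in> carrier_vec N" "?g = (\<Sum>r<N. a r * q $ r)"
    using image apply0 by (smt (verit) mem_Collect_eq)
  \<comment> \<open>The entries of the Koszul syzygy \<open>g p - f q\<close> vanish, since the kernel is zero.\<close>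
  have koszul: "?g * p $ r = ?f * q $ r" if r: "r < N" for r
  proof -
    let ?u = "vec N (\<lambda>r. ?g * p $ r - ?f * q $ r)"
    have scale: "(\<Sum>r<N. a r * (c * u $ r)) = c * (\<Sum>r<N. a r * u $ r)" for c and u :: "('n, 'k) mpoly vec"
      by (simp only: sum_distrib_left mult.left_commute[of c])
    have "(\<Sum>r<N. a r * ?u $ r) = (\<Sum>r<N. a r * (?g * p $ r) - a r * (?f * q $ r))"
      by (rule sum.cong[OF refl]) (simp only: lessThan_iff index_vec right_diff_distrib)
    also have "\<dots> = ?g * (\<Sum>r<N. a r * p $ r) - ?f * (\<Sum>r<N. a r * q $ r)"
      by (simp only: sum_subtractf scale)
    also have "\<dots> = 0" by (simp only: p(2)[symmetric] q(2)[symmetric] mult.commute diff_self)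
    finally show ?thesis using kernel_zero[of ?u r] r by simp
  qed
  \<comment> \<open>The monomial \<open>x\<^sub>C\<close> occurs in some \<open>a r * p $ r\<close>. As \<open>C\<close> is a minimal cover, the factor in \<open>a r\<close>
     is \<open>x\<^sub>C\<close> itself, so \<open>p $ r\<close> has a constant term and \<open>x\<^sub>D\<close> occurs in \<open>g p = f q\<close>, a multiple of \<open>x\<^sub>C\<close>.\<close>
  have "set_monomial C \<in> Poly_Mapping.keys (\<Sum>r<N. a r * p $ r)"
    unfolding p(2)[symmetric] by simp
  then obtain r where r: "r < N" "set_monomial C \<in> Poly_Mapping.keys (a r * p $ r)"
    using keys_sum[of "\<lambda>r. a r * p $ r" "{..<N}"] by auto
  then obtain m n where mn: "set_monomial C = m + n" "m \<in> Poly_Mapping.keys (a r)"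
      "n \<in> Poly_Mapping.keys (p $ r)"
    using keys_mult[of "a r" "p $ r"] by blast
  obtain B where B: "minimal_vertex_cover E B" "m = set_monomial B"
    using a_cover[OF r(1) mn(2)] by blast
  have "B \<subseteq> C"
  proof
    fix v assume "v \<in> B"
    then show "v \<in> C"
      using arg_cong[OF mn(1), of "\<lambda>p. Poly_Mapping.lookup p v"] B(2)
      by (auto simp: lookup_add split: if_splits)
  qed
  then have "B = C" using B(1) C by (auto simp: minimal_vertex_cover_def)
  then have "n = 0" using mn(1) B(2) by simp
  then have "Poly_Mapping.lookup (?g * p $ r) (set_monomial D) \<noteq> 0"
    using mn(3) lookup_single_mult_shift[of "set_monomial D" 1 "p $ r" 0]
    by (simp add: in_keys_iff)
  then have "set_monomial D \<in> Poly_Mapping.keys (?f * q $ r)"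
    using koszul[OF r(1)] by (simp add: in_keys_iff)
  then obtain n' where n': "set_monomial D = set_monomial C + n'"
    using keys_single_mult_subset by blast
  have "C \<subseteq> D"
  proof
    fix v assume "v \<in> C"
    then show "v \<in> D"
      using arg_cong[OF n', of "\<lambda>p. Poly_Mapping.lookup p v"]
      by (auto simp: lookup_add split: if_splits)
  qed
  then show False using C D \<open>C \<noteq> D\<close> by (auto simp: minimal_vertex_cover_def)
qed

text \<open>Dividing the equation \<open>x\<^sub>C x = x\<^sub>D y\<close> by \<open>x y\<close> gives \<open>W = C - {y} = D - {x}\<close>. Since \<open>W\<close> is
  smaller than \<open>\<alpha>\<close>, some edge avoids it, and both \<open>x\<close> and \<open>y\<close> are needed on that edge.\<close>

lemma covers_sharing_all_but_one_vertex:
  fixes E :: "'n::finite set set"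
  assumes "simple_graph E" "E \<noteq> {}"
    and "has_linear_resolution (cover_ideal E :: ('n, 'k::field) mpoly set)"
  obtains W x y where "x \<notin> W" "y \<notin> W" "{x, y} \<in> E"
    "vertex_cover E (insert x W)" "vertex_cover E (insert y W)"
    "Suc (card W) = alpha (cover_ideal E :: ('n, 'k) mpoly set)"
proof -
  obtain C D x y where C: "minimal_vertex_cover E C" and D: "minimal_vertex_cover E D"
    and card: "card C = alpha (cover_ideal E :: ('n, 'k) mpoly set)" and "x \<noteq> y"
    and eq: "set_monomial C + Poly_Mapping.single x 1 = set_monomial D + Poly_Mapping.single y 1"
    using cover_ideal_exchange_pair[OF assms] .
  define W where "W = C - {y}"
  have lk: "(if v \<in> C then 1 else 0) + (if x = v then 1 else 0)
      = (if v \<in> D then 1 else 0) + (if y = v then 1 else (0::nat))" for v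
    using arg_cong[OF eq, of "\<lambda>p. Poly_Mapping.lookup p v"]
    by (simp add: lookup_add lookup_single when_def del: One_nat_def split del: if_split)
  have x: "x \<notin> C" using lk[of x] \<open>x \<noteq> y\<close> by (auto split: if_splits)
  have y: "y \<in> C" using lk[of y] \<open>x \<noteq> y\<close> by (auto split: if_splits)
  have "v \<in> D \<longleftrightarrow> v \<in> insert x W" for v
    using lk[of v] x \<open>x \<noteq> y\<close> by (auto simp: W_def split: if_splits)
  then have "D = insert x W" by blast
  then have cx: "vertex_cover E (insert x W)" using D by (simp add: minimal_vertex_cover_def)
  have "C = insert y W" using y by (auto simp: W_def)
  then have cy: "vertex_cover E (insert y W)" using C by (simp add: minimal_vertex_cover_def)
  have cW: "Suc (card W) = alpha (cover_ideal E :: ('n, 'k) mpoly set)"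
    using y card unfolding W_def by (metis card_Suc_Diff1 finite_code)
  have "\<not> vertex_cover E W"
    using alpha_le_card_cover[of E W, where 'k = 'k] cW by auto
  then obtain e where e: "e \<in> E" "W \<inter> e = {}" by (auto simp: vertex_cover_def)
  then have "x \<in> e" "y \<in> e" using cx cy by (auto simp: vertex_cover_def)
  moreover have "card e = 2" using e(1) assms(1) by (simp add: simple_graph_def)
  ultimately have "{x, y} = e"
    using \<open>x \<noteq> y\<close> by (auto simp: card_2_iff)
  then show thesis
    using that[of x W y] x cx cy cW e(1) by (auto simp: W_def)
qed


section \<open>The v-number\<close>

text \<open>A prime of the form \<open>(J\<^sup>k : f)\<close> contains a variable, and multiplying \<open>f\<close> by this variable lands in
  \<open>J\<^sup>k\<close>. The variable comes from the cover \<open>C\<close>, since \<open>x\<^sub>C\<^sup>k \<in> J\<^sup>k\<close>.\<close>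

lemma v_number_ge:
  fixes E :: "'n::finite set set" and f :: "('n, 'k::field) mpoly"
  assumes "f \<in> homog d" "colon (ideal_power (cover_ideal E) k) f = P" "prime_ideal P"
    and "vertex_cover E C"
  shows "alpha (cover_ideal E :: ('n, 'k) mpoly set) * k \<le> Suc d"
proof -
  let ?J = "cover_ideal E :: ('n, 'k) mpoly set"
  let ?c = "\<Prod>v\<in>C. var v :: ('n, 'k) mpoly"
  have sub: "self_module.subspace (ideal_power ?J k)" by (rule subspace_ideal_power)
  have "?c ^ k \<in> ideal_power ?J k"
    using cover_in_cover_ideal[OF assms(4)] by (intro power_in_ideal_power) (simp add: prod_var)
  then have "f * ?c ^ k \<in> ideal_power ?J k" by (rule self_module.subspace_scale[OF sub])
  then have "?c ^ k \<in> P" using assms(2) by (auto simp: colon_def mult.commute)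
  then have "?c \<in> P" using assms(3) prime_ideal_power by blast
  then obtain v where "var v \<in> P"
    using assms(3) prime_ideal_prod[of P C var] by auto
  then have vf: "var v * f \<in> ideal_power ?J k" using assms(2) by (auto simp: colon_def)
  have "f \<noteq> 0"
    using assms(2,3) self_module.subspace_0[OF sub] by (auto simp: colon_def prime_ideal_def)
  then obtain m where m: "m \<in> Poly_Mapping.keys f" by fastforce
  have "Poly_Mapping.single v 1 + m \<in> Poly_Mapping.keys (var v * f)"
    using m by (simp add: in_keys_iff var_def lookup_single_mult_shift)
  then have "alpha ?J * k \<le> mon_deg (Poly_Mapping.single v 1 + m)"
    using weight_of_keys_ideal_power[of mon_deg ?J "alpha ?J", OF mon_deg_add]
      alpha_le_deg_key_of_cover_ideal vf by blast
  also have "\<dots> = Suc d" using m assms(1) by (simp add: mon_deg_add homog_def)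
  finally show ?thesis .
qed

text \<open>The monomial on the left is \<open>x\<^bsub>W \<union> {x}\<^esub>\<^sup>k x\<^sub>W\<close>, where \<open>x\<close> occurs exactly \<open>k\<close> times and \<open>y\<close> not at
  all. The joint degree in \<open>x\<close> and \<open>y\<close> is at least \<open>k + 1\<close> on the \<open>(k + 1)\<close>-st power of the cover ideal,
  so one further factor \<open>x\<close> or \<open>y\<close> is necessary; it is sufficient because it completes \<open>x\<^sub>W\<close> to a
  cover monomial.\<close>

lemma colon_ideal_power_eq_edge_prime:
  fixes E :: "'n::finite set set"
  assumes "x \<notin> W" "y \<notin> W" "{x, y} \<in> E" "x \<noteq> y"
    and "vertex_cover E (insert x W)" "vertex_cover E (insert y W)"
  shows "colon (ideal_power (cover_ideal E) (Suc k))
      (Poly_Mapping.single ((\<Sum>i<k. set_monomial (insert x W)) + set_monomial W) 1)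
    = (monomial_span {m. \<exists>v\<in>{x, y}. Poly_Mapping.lookup m v \<noteq> 0} :: ('n, 'k::field) mpoly set)"
    (is "colon ?Jk (Poly_Mapping.single ?F 1) = ?P")
proof (rule subset_antisym)
  let ?J = "cover_ideal E :: ('n, 'k) mpoly set"
  define L :: "('n \<Rightarrow>\<^sub>0 nat) \<Rightarrow> nat"
    where "L m = Poly_Mapping.lookup m x + Poly_Mapping.lookup m y" for m
  have L_add: "L (m + n) = L m + L n" for m n by (simp add: L_def lookup_add)
  have L_J: "1 \<le> L m" if f: "f \<in> ?J" and m: "m \<in> Poly_Mapping.keys f" for f m
  proof -
    obtain C where C: "minimal_vertex_cover E C" "C \<subseteq> Poly_Mapping.keys m"
      using key_of_cover_ideal[OF f m] .
    then have "x \<in> C \<or> y \<in> C"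
      using assms(3) by (auto simp: minimal_vertex_cover_def vertex_cover_def)
    then show ?thesis using C(2) by (auto simp: L_def in_keys_iff Suc_le_eq)
  qed
  show "colon ?Jk (Poly_Mapping.single ?F 1) \<subseteq> ?P"
  proof
    fix g assume g: "g \<in> colon ?Jk (Poly_Mapping.single ?F 1)"
    have "1 \<le> L m" if m: "m \<in> Poly_Mapping.keys g" for m
    proof -
      have "?F + m \<in> Poly_Mapping.keys (Poly_Mapping.single ?F 1 * g)"
        using m by (simp add: in_keys_iff lookup_single_mult_shift)
      moreover have "Poly_Mapping.single ?F 1 * g \<in> ?Jk"
        using g by (simp add: colon_def mult.commute)
      ultimately have "1 * Suc k \<le> L (?F + m)"
        using weight_of_keys_ideal_power[where L = L and I = ?J and a = 1] L_add L_J by metis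
      moreover have "L ?F = k" using assms(1,2,4) by (simp add: L_def lookup_add lookup_sum)
      ultimately show ?thesis by (simp add: L_add)
    qed
    then show "g \<in> ?P" by (auto simp: monomial_span_def L_def) fastforce
  qed
  have sub: "self_module.subspace ?Jk" by (rule subspace_ideal_power)
  let ?X = "Poly_Mapping.single (set_monomial (insert x W)) 1 :: ('n, 'k) mpoly"
  have F: "Poly_Mapping.single ?F 1 = ?X ^ k * Poly_Mapping.single (set_monomial W) 1"
    by (simp add: single_power mult_single)
  have var_F: "Poly_Mapping.single (Poly_Mapping.single v 1) 1 * Poly_Mapping.single ?F 1 \<in> ?Jk"
    if v: "v \<in> {x, y}" for v
  proof -
    have "vertex_cover E (insert v W)" and nW: "v \<notin> W" using v assms by auto
    then have "Poly_Mapping.single (set_monomial (insert v W)) 1 * ?X ^ k \<in> ?Jk"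
      using cover_in_cover_ideal assms(5)
      by (intro mult_in_ideal_power_Suc power_in_ideal_power) auto
    also have "set_monomial (insert v W) = Poly_Mapping.single v 1 + set_monomial W"
      using nW by (simp add: set_monomial_def)
    finally show ?thesis
      by (simp add: single_power mult_single add_ac del: ideal_power.simps)
  qed
  show "?P \<subseteq> colon ?Jk (Poly_Mapping.single ?F 1)"
  proof (rule monomial_span_subset_ideal)
    show "self_module.subspace (colon ?Jk (Poly_Mapping.single ?F 1))"
      using sub by (rule subspace_colon)
    fix m :: "'n \<Rightarrow>\<^sub>0 nat" and c :: 'k assume "m \<in> {m. \<exists>v\<in>{x, y}. Poly_Mapping.lookup m v \<noteq> 0}"
    then obtain v where v: "v \<in> {x, y}" "Poly_Mapping.lookup m v \<noteq> 0" by blast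
    have m: "m = (m - Poly_Mapping.single v 1) + Poly_Mapping.single v 1"
      using v(2) by (intro poly_mapping_eqI) (auto simp: lookup_add lookup_minus lookup_single when_def)
    have "Poly_Mapping.single m c * Poly_Mapping.single ?F 1
      = Poly_Mapping.single (m - Poly_Mapping.single v 1) c *
        (Poly_Mapping.single (Poly_Mapping.single v 1) 1 * Poly_Mapping.single ?F 1)"
      by (subst m) (simp add: mult_single add.assoc)
    then show "Poly_Mapping.single m c \<in> colon ?Jk (Poly_Mapping.single ?F 1)"
      using self_module.subspace_scale[OF sub var_F[OF v(1)]] by (simp add: colon_def del: ideal_power.simps)
  qed
qed

theorem corollary4p2:
  fixes E :: "'n::finite set set" and k :: nat
  assumes "simple_graph E" and "E \<noteq> {}"
    and "has_linear_resolution (cover_ideal E :: ('n, 'k::field) mpoly set)"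
    and "k \<ge> 1"
  shows "int (v_number (ideal_power (cover_ideal E :: ('n, 'k) mpoly set) k))
    = int (alpha (cover_ideal E :: ('n, 'k) mpoly set)) * int k - 1"
proof -
  let ?J = "cover_ideal E :: ('n, 'k) mpoly set"
  obtain W x y where W: "x \<notin> W" "y \<notin> W" "{x, y} \<in> E"
    "vertex_cover E (insert x W)" "vertex_cover E (insert y W)" "Suc (card W) = alpha ?J"
    using covers_sharing_all_but_one_vertex[OF assms(1-3)] .
  have "x \<noteq> y" using W(3) assms(1) by (auto simp: simple_graph_def)
  obtain l where k: "k = Suc l" using assms(4) by (cases k) auto
  define F where "F = (\<Sum>i<l. set_monomial (insert x W)) + set_monomial W"
  let ?f = "Poly_Mapping.single F 1 :: ('n, 'k) mpoly"
  let ?P = "monomial_span {m. \<exists>v\<in>{x, y}. Poly_Mapping.lookup m v \<noteq> 0} :: ('n, 'k) mpoly set"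
  have colon: "colon (ideal_power ?J k) ?f = ?P"
    unfolding k F_def using colon_ideal_power_eq_edge_prime W \<open>x \<noteq> y\<close> by blast
  have P: "?P \<in> Ass (ideal_power ?J k)"
    using prime_ideal_vars[of "{x, y}"] colon[symmetric] unfolding Ass_def by blast
  have "mon_deg F = alpha ?J * k - 1"
    using W(1) by (simp add: F_def mon_deg_add k W(6)[symmetric])
  then have f: "?f \<in> homog (alpha ?J * k - 1)" by (simp add: homog_def)
  have "v_number (ideal_power ?J k) = alpha ?J * k - 1"
    unfolding v_number_def
  proof (rule Least_equality)
    show "\<exists>f\<in>homog (alpha ?J * k - 1). \<exists>P\<in>Ass (ideal_power ?J k). colon (ideal_power ?J k) f = P"
      using f P colon by blast
    fix d assume "\<exists>f\<in>homog d. \<exists>P\<in>Ass (ideal_power ?J k). colon (ideal_power ?J k) f = P"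
    then obtain f P where "f \<in> homog d" "colon (ideal_power ?J k) f = P" "prime_ideal P"
      by (auto simp: Ass_def)
    then have "alpha ?J * k \<le> Suc d" using v_number_ge W(4) by blast
    then show "alpha ?J * k - 1 \<le> d" by simp
  qed
  moreover have "1 \<le> alpha ?J * k" using W(6)[symmetric] k by simp
  ultimately show ?thesis by (simp add: of_nat_diff)
qed

end
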